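(* Let $\mathcal{X}$ be a finite non-empty set with $|\mathcal{X}|=n$, let $p\in\Sigma_\mathcal{X}$ be a probability mass function on $\mathcal{X}$ with $p(x)>0$ for all $x\in\mathcal{X}$, let $\delta\geq0$ and let $f\colon\mathcal{X}\to\mathbb{R}$. Order the elements of $\mathcal{X}=\{x_1,\ldots,x_n\}$ such that $f(x_1)\leq f(x_2)\leq\cdots\leq f(x_n)$, and let $\ell$ be the largest index such that $f(x_\ell)=f(x_1)$. For $k\in\{\ell,\ldots,n\}$, let $m_k,\mu_k,\sigma_k^2,\delta_k$ be as defined in the context, with $\sigma_k\ge 0$ the square root of $\sigma_k^2$. Let $r\in\{\ell,\ldots,n\}$ be the largest index such that $\delta_r>\delta$. Then \[ \underline{E}^{\chi^2}_{p,\delta}(f)=\begin{cases}\mu_r-\sigma_r\sqrt{m_r\delta-(1-m_r)} & \text{if } r>\ell,\\ f(x_1) & \text{if } r=\ell.\end{cases} \]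
   Context: $\Sigma_\mathcal{X}$ denotes the set of all probability mass functions on the finite set $\mathcal{X}$. For $q\in\Sigma_\mathcal{X}$ and $f\colon\mathcal{X}\to\mathbb{R}$, $E_q(f):=\sum_{x\in\mathcal{X}}q(x)f(x)$. For strictly positive $p\in\Sigma_\mathcal{X}$, the $\chi^2$-divergence is $d_{\chi^2}(q,p):=\sum_{x\in\mathcal{X}}\frac{(q(x)-p(x))^2}{p(x)}$, the corresponding ball is $B_{\chi^2}(p,\delta):=\{q\in\Sigma_\mathcal{X}: d_{\chi^2}(q,p)\leq\delta\}$, and the corresponding lower expectation is $\underline{E}^{\chi^2}_{p,\delta}(f):=\inf_{q\in B_{\chi^2}(p,\delta)}E_q(f)$. With $\mathcal{X}=\{x_1,\ldots,x_n\}$ ordered so that $f(x_1)\leq\cdots\leq f(x_n)$ and $\ell$ the largest index with $f(x_\ell)=f(x_1)$, for any $k\in\{\ell,\ldots,n\}$ define \[ m_k:=\sum_{i=1}^k p(x_i),\quad \mu_k:=\frac{1}{m_k}\sum_{i=1}^k p(x_i)f(x_i),\quad \sigma_k^2:=\frac{1}{m_k}\sum_{i=1}^k p(x_i)(f(x_i)-\mu_k)^2. \] Let $\delta_\ell:=+\infty$ and, for any $k\in\{\ell+1,\ldots,n\}$, \[ \delta_k:=\frac{1}{m_k}\left(\frac{\sigma_k^2}{(f(x_k)-\mu_k)^2}+1-m_k\right). \] *)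

theory Defs
  imports "HOL-Probability.Probability"
begin

text \<open>A probability mass function on a finite set \<open>X\<close> is represented by a library \<open>pmf\<close> on the
  ambient type whose support is contained in \<open>X\<close>.\<close>

definition pmfs_on :: "'a set \<Rightarrow> 'a pmf set" where
  "pmfs_on X = {q. set_pmf q \<subseteq> X}"

definition expect_on :: "'a set \<Rightarrow> 'a pmf \<Rightarrow> ('a \<Rightarrow> real) \<Rightarrow> real" where
  "expect_on X q f = (\<Sum>x\<in>X. pmf q x * f x)"

text \<open>Only meant for \<open>p\<close> that is strictly positive on \<open>X\<close>; no junk value of division by zero
  arises then.\<close>

definition chi2_div :: "'a set \<Rightarrow> 'a pmf \<Rightarrow> 'a pmf \<Rightarrow> real" where
  "chi2_div X q p = (\<Sum>x\<in>X. (pmf q x - pmf p x)\<^sup>2 / pmf p x)"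

definition chi2_ball :: "'a set \<Rightarrow> 'a pmf \<Rightarrow> real \<Rightarrow> 'a pmf set" where
  "chi2_ball X p \<delta> = {q \<in> pmfs_on X. chi2_div X q p \<le> \<delta>}"

text \<open>For \<open>\<delta> \<ge> 0\<close> the ball contains \<open>p\<close>, and expectations are bounded below on it (\<open>X\<close> being
  finite), so the real-valued infimum is the genuine one.\<close>

definition chi2_lower_expectation :: "'a set \<Rightarrow> 'a pmf \<Rightarrow> real \<Rightarrow> ('a \<Rightarrow> real) \<Rightarrow> real" where
  "chi2_lower_expectation X p \<delta> f = (INF q\<in>chi2_ball X p \<delta>. expect_on X q f)"

text \<open>Below, \<open>xs 1, \<dots>, xs n\<close> enumerates the finite set with \<open>f (xs 1) \<le> \<dots> \<le> f (xs n)\<close>;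
  values of \<open>xs\<close> outside \<open>{1..n}\<close> are irrelevant.\<close>

definition last_min_index :: "('a \<Rightarrow> real) \<Rightarrow> (nat \<Rightarrow> 'a) \<Rightarrow> nat \<Rightarrow> nat" where
  "last_min_index f xs n = Max {i \<in> {1..n}. f (xs i) = f (xs 1)}"

definition partial_mass :: "'a pmf \<Rightarrow> (nat \<Rightarrow> 'a) \<Rightarrow> nat \<Rightarrow> real" where
  "partial_mass p xs k = (\<Sum>i=1..k. pmf p (xs i))"

definition partial_mean :: "'a pmf \<Rightarrow> ('a \<Rightarrow> real) \<Rightarrow> (nat \<Rightarrow> 'a) \<Rightarrow> nat \<Rightarrow> real" where
  "partial_mean p f xs k =
     1 / partial_mass p xs k * (\<Sum>i=1..k. pmf p (xs i) * f (xs i))"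

definition partial_var :: "'a pmf \<Rightarrow> ('a \<Rightarrow> real) \<Rightarrow> (nat \<Rightarrow> 'a) \<Rightarrow> nat \<Rightarrow> real" where
  "partial_var p f xs k =
     1 / partial_mass p xs k * (\<Sum>i=1..k. pmf p (xs i) * (f (xs i) - partial_mean p f xs k)\<^sup>2)"

definition partial_sd :: "'a pmf \<Rightarrow> ('a \<Rightarrow> real) \<Rightarrow> (nat \<Rightarrow> 'a) \<Rightarrow> nat \<Rightarrow> real" where
  "partial_sd p f xs k = sqrt (partial_var p f xs k)"

text \<open>Only meant for indices \<open>k\<close> between \<open>last_min_index f xs n\<close> and \<open>n\<close>. For \<open>k\<close> above the
  former, \<open>f (xs k)\<close> exceeds the partial mean, so the denominator is nonzero.\<close>

definition delta_threshold ::
    "'a pmf \<Rightarrow> ('a \<Rightarrow> real) \<Rightarrow> (nat \<Rightarrow> 'a) \<Rightarrow> nat \<Rightarrow> nat \<Rightarrow> ereal" where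
  "delta_threshold p f xs n k =
     (if k = last_min_index f xs n then \<infinity>
      else ereal (1 / partial_mass p xs k *
             (partial_var p f xs k / (f (xs k) - partial_mean p f xs k)\<^sup>2
                + 1 - partial_mass p xs k)))"

end

theory Submission
  imports Defs
begin

text \<open>
  Since \<open>1 + chi2_div X q p\<close> is the sum of \<open>q\<^sup>2 / p\<close>, the problem is to minimise a linear function of
  \<open>q\<close> over a Euclidean ball for the inner product weighted by \<open>1 / p\<close>, intersected with the
  simplex. By the Kuhn-Tucker conditions, a pmf \<open>q\<close> on the boundary of the ball is optimal as soon
  as its density \<open>q / p\<close> is the positive part of a decreasing affine function of \<open>f\<close>; this needs
  only the Cauchy-Schwarz inequality (\<open>chi2_lower_expectation_lagrange\<close>).

  The positive part of a decreasing affine function of \<open>f\<close> lives on an initial segment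
  \<open>xs 1, \<dots>, xs k\<close>. On that segment, the normalised candidates are the conditional law
  \<open>p / m k\<close> times \<open>1 - c * (f - \<mu> k)\<close>. Their divergence and their expectation of \<open>f\<close> are explicit in
  \<open>c\<close> (\<open>tilted_pmf\<close>): being on the boundary of the ball forces
  \<open>c\<^sup>2 * v k = m k * (1 + \<delta>) - 1\<close>, with \<open>v k\<close> the partial variance, and the expectation
  \<open>\<mu> k - c * v k\<close> becomes the claimed value. What remains is to find the segment for which this candidate
  is the positive part of its affine function, which means \<open>c * (f (xs k) - \<mu> k) \<le> 1\<close>
  and \<open>1 \<le> c * (f (xs (k + 1)) - \<mu> k)\<close>.

  The thresholds encode precisely these two inequalities. Completing the square gives
  \<open>1 + \<delta>\<^sub>k = (\<Sum>i\<le>k. p (xs i) * (f (xs k) - f (xs i))\<^sup>2) / (\<Sum>i\<le>k. p (xs i) * (f (xs k) - f (xs i)))\<^sup>2\<close>.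
  The terms with \<open>i = k\<close> vanish, so \<open>\<delta>\<^sub>k\<close> can be expressed through the moments of the
  segment of length \<open>k\<close> as well as through those of the segment of length \<open>k - 1\<close>
  (\<open>threshold_same\<close>, \<open>threshold_Suc\<close>). The first form turns \<open>\<delta> < \<delta>\<^sub>r\<close> into the first inequality at
  \<open>k = r\<close>, the second form turns \<open>\<delta>\<^sub>r\<^sub>+\<^sub>1 \<le> \<delta>\<close> into the second one.

  Two degenerate situations remain. If \<open>r\<close> is the index of the last minimiser of \<open>f\<close>, the ball is
  large enough to contain \<open>p\<close> conditioned on the minimisers. If \<open>\<delta> = 0\<close> and
  \<open>r = n\<close>, the multiplier \<open>c\<close> vanishes and carries no information, but then the ball is \<open>{p}\<close>.
\<close>

section \<open>Optimality in a chi-square ball\<close>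

lemma sum_pmf_on:
  assumes "finite X" "q \<in> pmfs_on X"
  shows "(\<Sum>x\<in>X. pmf q x) = 1"
  using assms by (simp add: pmfs_on_def sum_pmf_eq_1)

lemma pmf_on_exists:
  fixes w :: "'a \<Rightarrow> real"
  assumes fin: "finite X" and nonneg: "\<And>x. x \<in> X \<Longrightarrow> 0 \<le> w x" and total: "(\<Sum>x\<in>X. w x) = 1"
  obtains q where "q \<in> pmfs_on X" and "\<And>x. x \<in> X \<Longrightarrow> pmf q x = w x"
proof -
  define v where "v x = (if x \<in> X then w x else 0)" for x
  have v_nonneg: "\<And>x. 0 \<le> v x" using nonneg by (simp add: v_def)
  have "(\<integral>\<^sup>+ x. ennreal (v x) \<partial>count_space UNIV) = (\<Sum>x\<in>X. ennreal (v x))"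
    by (rule nn_integral_count_space'[OF fin]) (auto simp: v_def)
  also have "\<dots> = ennreal (\<Sum>x\<in>X. v x)" using v_nonneg by (simp add: sum_ennreal)
  also have "(\<Sum>x\<in>X. v x) = 1" using total by (simp add: v_def)
  finally have one: "(\<integral>\<^sup>+ x. ennreal (v x) \<partial>count_space UNIV) = 1" by simp
  have pmf_v: "pmf (embed_pmf v) x = v x" for x
    using v_nonneg one by (rule pmf_embed_pmf)
  have "embed_pmf v \<in> pmfs_on X"
    by (auto simp: pmfs_on_def set_pmf_iff pmf_v v_def split: if_splits)
  moreover have "pmf (embed_pmf v) x = w x" if "x \<in> X" for x
    using that by (simp add: pmf_v v_def)
  ultimately show ?thesis by (rule that)
qed

text \<open>This form is what makes the ball a Euclidean one, centred at the origin.\<close>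

lemma chi2_div_second_moment:
  assumes fin: "finite X" and p: "p \<in> pmfs_on X" and pos: "\<And>x. x \<in> X \<Longrightarrow> 0 < pmf p x"
    and q: "q \<in> pmfs_on X"
  shows "chi2_div X q p = (\<Sum>x\<in>X. (pmf q x)\<^sup>2 / pmf p x) - 1"
proof -
  have "chi2_div X q p = (\<Sum>x\<in>X. (pmf q x)\<^sup>2 / pmf p x - 2 * pmf q x + pmf p x)"
    unfolding chi2_div_def
  proof (rule sum.cong[OF refl])
    fix x assume "x \<in> X"
    then show "(pmf q x - pmf p x)\<^sup>2 / pmf p x = (pmf q x)\<^sup>2 / pmf p x - 2 * pmf q x + pmf p x"
      using pos[of x] by (simp add: field_simps power2_eq_square)
  qed
  also have "\<dots> = (\<Sum>x\<in>X. (pmf q x)\<^sup>2 / pmf p x) - 2 * (\<Sum>x\<in>X. pmf q x) + (\<Sum>x\<in>X. pmf p x)"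
    by (simp add: sum.distrib sum_subtractf sum_distrib_left)
  finally show ?thesis using sum_pmf_on[OF fin p] sum_pmf_on[OF fin q] by simp
qed

lemma chi2_ball_zero:
  assumes fin: "finite X" and p: "p \<in> pmfs_on X" and pos: "\<And>x. x \<in> X \<Longrightarrow> 0 < pmf p x"
  shows "chi2_ball X p 0 = {p}"
proof -
  have "q = p" if "q \<in> chi2_ball X p 0" for q
  proof (rule pmf_eqI)
    fix x
    have q: "q \<in> pmfs_on X" and div: "chi2_div X q p \<le> 0"
      using that by (auto simp: chi2_ball_def)
    have terms: "0 \<le> (pmf q y - pmf p y)\<^sup>2 / pmf p y" if "y \<in> X" for y
      using pos[OF that] by simp
    have "chi2_div X q p = 0"
      using div terms by (auto simp: chi2_div_def intro!: antisym sum_nonneg)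
    then have zero: "(pmf q y - pmf p y)\<^sup>2 / pmf p y = 0" if "y \<in> X" for y
      using sum_nonneg_eq_0_iff[OF fin, of "\<lambda>y. (pmf q y - pmf p y)\<^sup>2 / pmf p y"] terms that
      by (auto simp: chi2_div_def)
    show "pmf q x = pmf p x"
    proof (cases "x \<in> X")
      case True
      then show ?thesis using zero[OF True] pos[OF True] by simp
    next
      case False
      then have "x \<notin> set_pmf q" "x \<notin> set_pmf p" using p q by (auto simp: pmfs_on_def)
      then show ?thesis by (simp add: pmf_eq_0_set_pmf[symmetric])
    qed
  qed
  moreover have "p \<in> chi2_ball X p 0" using p by (simp add: chi2_ball_def chi2_div_def)
  ultimately show ?thesis by auto
qed

lemma chi2_lower_expectation_eqI:
  assumes "q \<in> chi2_ball X p \<delta>"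
    and "\<And>q'. q' \<in> chi2_ball X p \<delta> \<Longrightarrow> expect_on X q f \<le> expect_on X q' f"
  shows "chi2_lower_expectation X p \<delta> f = expect_on X q f"
  unfolding chi2_lower_expectation_def using assms by (intro cInf_eq_minimum) auto

text \<open>Sufficiency of the Kuhn-Tucker conditions. The premises \<open>dual\<close> and \<open>slack\<close> say that the density
  \<open>q / p\<close> is the positive part of \<open>a - c * f\<close>. For any other \<open>q'\<close> in the ball,
  \<open>a - c * expect_on X q' f\<close> is at most the inner product of \<open>q'\<close> and \<open>q\<close> weighted by \<open>1 / p\<close>, hence at most
  \<open>1 + \<delta>\<close> by Cauchy-Schwarz, and \<open>q\<close> attains equality throughout.\<close>

lemma chi2_lower_expectation_lagrange:
  assumes fin: "finite X" and p: "p \<in> pmfs_on X" and pos: "\<And>x. x \<in> X \<Longrightarrow> 0 < pmf p x"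
    and q: "q \<in> pmfs_on X" and boundary: "chi2_div X q p = \<delta>"
    and c: "0 < c"
    and dual: "\<And>x. x \<in> X \<Longrightarrow> pmf p x * (a - c * f x) \<le> pmf q x"
    and slack: "\<And>x. x \<in> X \<Longrightarrow> pmf q x = 0 \<or> pmf q x = pmf p x * (a - c * f x)"
  shows "chi2_lower_expectation X p \<delta> f = expect_on X q f"
proof (rule chi2_lower_expectation_eqI)
  show "q \<in> chi2_ball X p \<delta>" using q boundary by (simp add: chi2_ball_def)
next
  fix q' assume "q' \<in> chi2_ball X p \<delta>"
  then have q': "q' \<in> pmfs_on X" and div: "chi2_div X q' p \<le> \<delta>"
    by (auto simp: chi2_ball_def)
  have affine: "(\<Sum>x\<in>X. pmf u x * (a - c * f x)) = a - c * expect_on X u f"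
    if "u \<in> pmfs_on X" for u
  proof -
    have "(\<Sum>x\<in>X. pmf u x * (a - c * f x)) = a * (\<Sum>x\<in>X. pmf u x) - c * expect_on X u f"
      by (simp add: expect_on_def sum_distrib_left sum_subtractf[symmetric] algebra_simps)
    then show ?thesis using sum_pmf_on[OF fin that] by simp
  qed
  have sq: "(\<Sum>x\<in>X. (pmf q x)\<^sup>2 / pmf p x) = 1 + \<delta>" "(\<Sum>x\<in>X. (pmf q' x)\<^sup>2 / pmf p x) \<le> 1 + \<delta>"
    using chi2_div_second_moment[OF fin p pos q] chi2_div_second_moment[OF fin p pos q']
      boundary div by auto
  have "a - c * expect_on X q' f = (\<Sum>x\<in>X. pmf q' x * (a - c * f x))"
    using affine[OF q'] by simp
  also have "\<dots> \<le> (\<Sum>x\<in>X. pmf q' x * (pmf q x / pmf p x))"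
  proof (rule sum_mono)
    fix x assume "x \<in> X"
    then show "pmf q' x * (a - c * f x) \<le> pmf q' x * (pmf q x / pmf p x)"
      using dual[of x] pos[of x] by (intro mult_left_mono) (auto simp: field_simps)
  qed
  (* both vectors have squared norm at most 1 + \<delta>, so the arithmetic-geometric mean inequality,
     term by term, replaces Cauchy-Schwarz *)
  also have "\<dots> \<le> (\<Sum>x\<in>X. ((pmf q' x)\<^sup>2 / pmf p x + (pmf q x)\<^sup>2 / pmf p x) / 2)"
  proof (rule sum_mono)
    fix x assume "x \<in> X"
    have "2 * (pmf q' x * pmf q x) \<le> (pmf q' x)\<^sup>2 + (pmf q x)\<^sup>2"
      using sum_squares_bound[of "pmf q' x" "pmf q x"] by simp
    then show "pmf q' x * (pmf q x / pmf p x)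
        \<le> ((pmf q' x)\<^sup>2 / pmf p x + (pmf q x)\<^sup>2 / pmf p x) / 2"
      using pos[OF \<open>x \<in> X\<close>] by (simp add: add_divide_distrib[symmetric] divide_simps)
  qed
  also have "\<dots> \<le> (\<Sum>x\<in>X. (pmf q x)\<^sup>2 / pmf p x)"
    using sq by (simp add: sum_divide_distrib[symmetric] sum.distrib)
  also have "\<dots> = (\<Sum>x\<in>X. pmf q x * (a - c * f x))"
  proof (rule sum.cong[OF refl])
    fix x assume "x \<in> X"
    then show "(pmf q x)\<^sup>2 / pmf p x = pmf q x * (a - c * f x)"
      using slack[of x] pos[of x] by (auto simp: power2_eq_square)
  qed
  also have "\<dots> = a - c * expect_on X q f" by (rule affine[OF q])
  finally show "expect_on X q f \<le> expect_on X q' f" using c by simp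
qed

section \<open>Moments of initial segments\<close>

locale ordered_enumeration =
  fixes X :: "'a set" and p :: "'a pmf" and f :: "'a \<Rightarrow> real" and xs :: "nat \<Rightarrow> 'a" and n :: nat
  assumes fin: "finite X" and nonempty: "X \<noteq> {}"
    and p_on: "p \<in> pmfs_on X" and p_pos: "x \<in> X \<Longrightarrow> 0 < pmf p x"
    and bij: "bij_betw xs {1..n} X"
    and f_mono: "mono_on {1..n} (\<lambda>i. f (xs i))"
begin

abbreviation "m \<equiv> partial_mass p xs"
abbreviation "\<mu> \<equiv> partial_mean p f xs"
abbreviation "v \<equiv> partial_var p f xs"
abbreviation "l \<equiv> last_min_index f xs n"

lemma n_pos: "1 \<le> n"
  using bij nonempty by (cases n) (auto simp: bij_betw_def)

lemma xs_in: "i \<in> {1..n} \<Longrightarrow> xs i \<in> X"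
  using bij by (auto simp: bij_betw_def)

lemma f_le: "1 \<le> i \<Longrightarrow> i \<le> j \<Longrightarrow> j \<le> n \<Longrightarrow> f (xs i) \<le> f (xs j)"
  using f_mono by (auto simp: monotone_on_def)

lemma sum_reindex: "(\<Sum>x\<in>X. h x) = (\<Sum>i=1..n. h (xs i))"
  using sum.reindex_bij_betw[OF bij, of h] by simp

text \<open>The candidates for optimality vanish beyond some \<open>xs k\<close>; this turns their moments over \<open>X\<close> into
  partial sums.\<close>

lemma sum_initial_segment:
  assumes "k \<le> n" and "\<And>i. k < i \<Longrightarrow> i \<le> n \<Longrightarrow> h (xs i) = 0"
  shows "(\<Sum>x\<in>X. h x) = (\<Sum>i=1..k. h (xs i))"
  unfolding sum_reindex using assms by (intro sum.mono_neutral_right) auto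

lemma mass_pos: "k \<in> {1..n} \<Longrightarrow> 0 < m k"
  unfolding partial_mass_def by (intro sum_pos) (auto intro!: p_pos xs_in)

lemma mass_n: "m n = 1"
  using sum_pmf_on[OF fin p_on] by (simp add: sum_reindex partial_mass_def)

lemma mass_mean: "k \<in> {1..n} \<Longrightarrow> (\<Sum>i=1..k. pmf p (xs i) * f (xs i)) = m k * \<mu> k"
  using mass_pos[of k] by (simp add: partial_mean_def)

lemma mass_var:
  "k \<in> {1..n} \<Longrightarrow> (\<Sum>i=1..k. pmf p (xs i) * (f (xs i) - \<mu> k)\<^sup>2) = m k * v k"
  using mass_pos[of k] by (simp add: partial_var_def)

lemma first_moment_about:
  assumes "k \<in> {1..n}"
  shows "(\<Sum>i=1..k. pmf p (xs i) * (t - f (xs i))) = m k * (t - \<mu> k)"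
proof -
  have "(\<Sum>i=1..k. pmf p (xs i) * (t - f (xs i)))
      = t * m k - (\<Sum>i=1..k. pmf p (xs i) * f (xs i))"
    by (simp add: partial_mass_def sum_distrib_left sum_subtractf[symmetric] algebra_simps)
  then show ?thesis unfolding mass_mean[OF assms] by (simp add: algebra_simps)
qed

text \<open>Huygens' decomposition. With \<open>t = f (xs k)\<close> it relates the variance quotient in the
  threshold to a moment whose last term vanishes.\<close>

lemma second_moment_about:
  assumes "k \<in> {1..n}"
  shows "(\<Sum>i=1..k. pmf p (xs i) * (t - f (xs i))\<^sup>2) = m k * (v k + (t - \<mu> k)\<^sup>2)"
proof -
  have "pmf p (xs i) * (t - f (xs i))\<^sup>2
      = pmf p (xs i) * (f (xs i) - \<mu> k)\<^sup>2 + (t - \<mu> k)\<^sup>2 * pmf p (xs i)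
        + 2 * (t - \<mu> k) * (pmf p (xs i) * (\<mu> k - f (xs i)))" for i
    by (simp add: power2_eq_square algebra_simps)
  then have "(\<Sum>i=1..k. pmf p (xs i) * (t - f (xs i))\<^sup>2)
      = (\<Sum>i=1..k. pmf p (xs i) * (f (xs i) - \<mu> k)\<^sup>2) + (t - \<mu> k)\<^sup>2 * m k
        + 2 * (t - \<mu> k) * (\<Sum>i=1..k. pmf p (xs i) * (\<mu> k - f (xs i)))"
    by (simp add: sum.distrib sum_distrib_left partial_mass_def)
  then show ?thesis
    unfolding mass_var[OF assms] first_moment_about[OF assms] by (simp add: algebra_simps)
qed

lemma last_min: "l \<in> {1..n}" "f (xs l) = f (xs 1)"
proof -
  have "l \<in> {i \<in> {1..n}. f (xs i) = f (xs 1)}"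
    unfolding last_min_index_def using n_pos by (intro Max_in) auto
  then show "l \<in> {1..n}" "f (xs l) = f (xs 1)" by auto
qed

lemma f_min_less:
  assumes "l < k" "k \<le> n" shows "f (xs 1) < f (xs k)"
proof -
  have "f (xs k) \<noteq> f (xs 1)"
  proof
    assume "f (xs k) = f (xs 1)"
    then have "k \<le> l" unfolding last_min_index_def using assms by (intro Max_ge) auto
    then show False using assms by simp
  qed
  moreover have "f (xs 1) \<le> f (xs k)" using assms by (intro f_le) auto
  ultimately show ?thesis by simp
qed

lemma f_min_const:
  assumes "i \<in> {1..l}" shows "f (xs i) = f (xs 1)"
proof (rule antisym)
  show "f (xs i) \<le> f (xs 1)" using f_le[of i l] last_min assms by simp
  show "f (xs 1) \<le> f (xs i)" using f_le[of 1 i] last_min(1) assms by simp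
qed

lemma mean_l: "\<mu> l = f (xs 1)"
proof -
  have "(\<Sum>i=1..l. pmf p (xs i) * (f (xs 1) - f (xs i))) = 0"
  proof (rule sum.neutral, rule ballI)
    fix i assume "i \<in> {1..l}"
    from f_min_const[OF this] show "pmf p (xs i) * (f (xs 1) - f (xs i)) = 0" by simp
  qed
  then show ?thesis
    using first_moment_about[OF last_min(1), of "f (xs 1)"] mass_pos[OF last_min(1)] by simp
qed

lemma var_l: "v l = 0"
proof -
  have "(\<Sum>i=1..l. pmf p (xs i) * (f (xs i) - \<mu> l)\<^sup>2) = 0"
  proof (rule sum.neutral, rule ballI)
    fix i assume "i \<in> {1..l}"
    from f_min_const[OF this] show "pmf p (xs i) * (f (xs i) - \<mu> l)\<^sup>2 = 0"
      by (simp add: mean_l)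
  qed
  then show ?thesis using mass_var[OF last_min(1)] mass_pos[OF last_min(1)] by simp
qed

lemma mean_less:
  assumes "l < k" "k \<le> n" shows "\<mu> k < f (xs k)"
proof -
  have k: "k \<in> {1..n}" using assms by auto
  have "0 < (\<Sum>i=1..k. pmf p (xs i) * (f (xs k) - f (xs i)))"
  proof (rule sum_pos2[where i = 1])
    show "0 < pmf p (xs 1) * (f (xs k) - f (xs 1))"
      using f_min_less[OF assms] k by (intro mult_pos_pos p_pos xs_in) auto
    show "0 \<le> pmf p (xs i) * (f (xs k) - f (xs i))" if "i \<in> {1..k}" for i
      using f_le[of i k] that k by (intro mult_nonneg_nonneg) auto
  qed (use k in auto)
  then show ?thesis
    using first_moment_about[OF k] mass_pos[OF k] by (simp add: zero_less_mult_iff)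
qed

lemma var_pos:
  assumes "l < k" "k \<le> n" shows "0 < v k"
proof -
  have k: "k \<in> {1..n}" using assms by auto
  have "0 < (\<Sum>i=1..k. pmf p (xs i) * (f (xs i) - \<mu> k)\<^sup>2)"
  proof (rule sum_pos2[where i = k])
    show "0 < pmf p (xs k) * (f (xs k) - \<mu> k)\<^sup>2"
      using mean_less[OF assms] k by (intro mult_pos_pos p_pos xs_in) auto
  qed (use k in auto)
  then show ?thesis using mass_var[OF k] mass_pos[OF k] by (simp add: zero_less_mult_iff)
qed

section \<open>The thresholds\<close>

text \<open>The finite values of \<open>delta_threshold\<close>, as reals.\<close>

definition threshold :: "nat \<Rightarrow> real" where
  "threshold k = 1 / m k * (v k / (f (xs k) - \<mu> k)\<^sup>2 + 1 - m k)"

lemma delta_threshold_less_iff: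
  assumes "l < k"
  shows "ereal \<delta> < delta_threshold p f xs n k \<longleftrightarrow> \<delta> < threshold k"
  using assms by (simp add: delta_threshold_def threshold_def)

lemma threshold_same:
  assumes "l < k" "k \<le> n"
  shows "m k * (1 + threshold k) = 1 + v k / (f (xs k) - \<mu> k)\<^sup>2"
  using mass_pos[of k] assms by (simp add: threshold_def field_simps)

text \<open>The first moment about \<open>f (xs (k + 1))\<close> is the same for both segments, since the
  additional term vanishes.\<close>

lemma mean_less_Suc:
  assumes "l \<le> k" "Suc k \<le> n"
  shows "\<mu> k < f (xs (Suc k))"
proof -
  have k: "k \<in> {1..n}" "Suc k \<in> {1..n}" using assms last_min(1) by auto
  have "m k * (f (xs (Suc k)) - \<mu> k) = m (Suc k) * (f (xs (Suc k)) - \<mu> (Suc k))"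
    unfolding first_moment_about[OF k(1), symmetric] first_moment_about[OF k(2), symmetric]
    by simp
  moreover have "0 < m (Suc k) * (f (xs (Suc k)) - \<mu> (Suc k))"
    using mean_less[of "Suc k"] mass_pos[OF k(2)] assms by simp
  ultimately have "0 < m k * (f (xs (Suc k)) - \<mu> k)" by linarith
  then show ?thesis using mass_pos[OF k(1)] by (simp add: zero_less_mult_iff)
qed

text \<open>The last term of a moment about \<open>f (xs (k + 1))\<close> vanishes, so the segments of length \<open>k\<close> and
  \<open>k + 1\<close> have the same first and second moments about that point, and \<open>1 + threshold (k + 1)\<close>
  depends only on these.\<close>

lemma threshold_Suc:
  assumes "l \<le> k" "Suc k \<le> n"
  shows "m k * (1 + threshold (Suc k)) = 1 + v k / (f (xs (Suc k)) - \<mu> k)\<^sup>2"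
proof -
  have k: "k \<in> {1..n}" "Suc k \<in> {1..n}" using assms last_min(1) by auto
  define t where "t = f (xs (Suc k))"
  have first: "m (Suc k) * (t - \<mu> (Suc k)) = m k * (t - \<mu> k)"
    unfolding first_moment_about[OF k(1), symmetric] first_moment_about[OF k(2), symmetric]
    by (simp add: t_def)
  have second: "m (Suc k) * (v (Suc k) + (t - \<mu> (Suc k))\<^sup>2) = m k * (v k + (t - \<mu> k)\<^sup>2)"
    unfolding second_moment_about[OF k(1), symmetric] second_moment_about[OF k(2), symmetric]
    by (simp add: t_def)
  have less: "\<mu> (Suc k) < t" "\<mu> k < t"
    unfolding t_def using mean_less[of "Suc k"] mean_less_Suc assms by auto
  have pos: "0 < m k" "0 < m (Suc k)" using mass_pos k by auto
  (* the right-hand side is m j times the second moment about t over the squared first moment; only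
     the factor m j distinguishes j = k from j = Suc k *)
  have ratio: "1 + v j / (t - \<mu> j)\<^sup>2
      = m j * (m j * (v j + (t - \<mu> j)\<^sup>2)) / (m j * (t - \<mu> j))\<^sup>2"
    if "0 < m j" "\<mu> j < t" for j
    using that by (simp add: divide_simps power_mult_distrib) (simp add: power2_eq_square algebra_simps)
  have "m (Suc k) * (1 + threshold (Suc k)) = 1 + v (Suc k) / (t - \<mu> (Suc k))\<^sup>2"
    using threshold_same[of "Suc k"] assms by (simp add: t_def)
  also have "\<dots> = m (Suc k) * (m k * (v k + (t - \<mu> k)\<^sup>2) / (m k * (t - \<mu> k))\<^sup>2)"
    unfolding ratio[OF pos(2) less(1)] first second by simp
  finally have "1 + threshold (Suc k) = m k * (v k + (t - \<mu> k)\<^sup>2) / (m k * (t - \<mu> k))\<^sup>2"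
    using pos(2) by (subst (asm) mult_cancel_left) simp
  then show ?thesis
    using ratio[OF pos(1) less(2)] by (simp add: t_def)
qed

section \<open>Affine tilts of initial segments\<close>

text \<open>The factor \<open>1 - c * (f - \<mu> k)\<close> has mean 1 under \<open>p\<close> conditioned on the segment, so the tilted weights
  already sum to one. Its second moment is \<open>1 + c\<^sup>2 * v k\<close>, and its covariance with \<open>f\<close> is
  \<open>- c * v k\<close>. The value \<open>c = 0\<close> gives the conditional law itself.\<close>

lemma tilted_pmf:
  assumes k: "k \<in> {1..n}" and tilt: "\<And>i. i \<in> {1..k} \<Longrightarrow> c * (f (xs i) - \<mu> k) \<le> 1"
  obtains q where "q \<in> pmfs_on X"
    and "\<And>i. i \<in> {1..n} \<Longrightarrow>
      pmf q (xs i) = (if i \<le> k then pmf p (xs i) / m k * (1 - c * (f (xs i) - \<mu> k)) else 0)"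
    and "chi2_div X q p = (1 + c\<^sup>2 * v k) / m k - 1"
    and "expect_on X q f = \<mu> k - c * v k"
proof -
  define w where
    "w x = (if x \<in> xs ` {1..k} then pmf p x / m k * (1 - c * (f x - \<mu> k)) else 0)" for x
  have mk: "0 < m k" by (rule mass_pos[OF k])
  have inj: "inj_on xs {1..n}" using bij by (simp add: bij_betw_def)
  have w_xs: "w (xs i) = (if i \<le> k then pmf p (xs i) / m k * (1 - c * (f (xs i) - \<mu> k)) else 0)"
    if "i \<in> {1..n}" for i
    using inj_on_image_mem_iff[OF inj that, of "{1..k}"] k that by (auto simp: w_def)
  have w_low: "w (xs i) = pmf p (xs i) / m k * (1 - c * (f (xs i) - \<mu> k))"
    if "i \<in> {1..k}" for i using w_xs[of i] that k by auto
  have w_high: "w (xs i) = 0" if "k < i" "i \<le> n" for i using w_xs[of i] that by auto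
  have mean0: "(\<Sum>i=1..k. pmf p (xs i) * (\<mu> k - f (xs i))) = 0"
    using first_moment_about[OF k, of "\<mu> k"] by simp
  have "(\<Sum>x\<in>X. w x) = (\<Sum>i=1..k. w (xs i))"
    using k w_high by (intro sum_initial_segment) auto
  also have "\<dots> = (\<Sum>i=1..k. pmf p (xs i) / m k + c / m k * (pmf p (xs i) * (\<mu> k - f (xs i))))"
    using mk by (intro sum.cong[OF refl]) (simp add: w_low field_simps)
  also have "\<dots> = (\<Sum>i=1..k. pmf p (xs i)) / m k"
    by (simp only: sum.distrib sum_divide_distrib[symmetric] sum_distrib_left[symmetric] mean0
        mult_zero_right add_0_right)
  also have "\<dots> = 1" using mk by (simp add: partial_mass_def)
  finally have total: "(\<Sum>x\<in>X. w x) = 1" .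
  have "0 \<le> w x" for x
    using tilt mk by (auto simp: w_def intro!: mult_nonneg_nonneg)
  then obtain q where q: "q \<in> pmfs_on X" and pmf_q: "\<And>x. x \<in> X \<Longrightarrow> pmf q x = w x"
    using pmf_on_exists[OF fin _ total] by blast
  have pk: "0 < pmf p (xs i)" if "i \<in> {1..k}" for i
    using that k by (intro p_pos xs_in) auto
  have "(\<Sum>x\<in>X. (pmf q x)\<^sup>2 / pmf p x) = (\<Sum>x\<in>X. (w x)\<^sup>2 / pmf p x)"
    by (rule sum.cong) (simp_all add: pmf_q)
  also have "\<dots> = (\<Sum>i=1..k. (w (xs i))\<^sup>2 / pmf p (xs i))"
    using k w_high by (intro sum_initial_segment) auto
  also have "\<dots> = (\<Sum>i=1..k. pmf p (xs i) / (m k)\<^sup>2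
      + 2 * c / (m k)\<^sup>2 * (pmf p (xs i) * (\<mu> k - f (xs i)))
      + c\<^sup>2 / (m k)\<^sup>2 * (pmf p (xs i) * (f (xs i) - \<mu> k)\<^sup>2))"
  proof (rule sum.cong[OF refl])
    fix i assume "i \<in> {1..k}"
    then show "(w (xs i))\<^sup>2 / pmf p (xs i) = pmf p (xs i) / (m k)\<^sup>2
      + 2 * c / (m k)\<^sup>2 * (pmf p (xs i) * (\<mu> k - f (xs i)))
      + c\<^sup>2 / (m k)\<^sup>2 * (pmf p (xs i) * (f (xs i) - \<mu> k)\<^sup>2)"
      using pk[of i] mk by (simp add: w_low divide_simps) (simp add: power2_eq_square algebra_simps)
  qed
  also have "\<dots> = m k / (m k)\<^sup>2 + c\<^sup>2 / (m k)\<^sup>2 * (m k * v k)"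
    by (simp only: sum.distrib sum_divide_distrib[symmetric] sum_distrib_left[symmetric] mean0
        mass_var[OF k]) (simp add: partial_mass_def)
  also have "\<dots> = (1 + c\<^sup>2 * v k) / m k"
    using mk by (simp add: power2_eq_square field_simps)
  finally have div: "chi2_div X q p = (1 + c\<^sup>2 * v k) / m k - 1"
    using chi2_div_second_moment[OF fin p_on p_pos q] by simp
  have "expect_on X q f = (\<Sum>x\<in>X. w x * f x)"
    unfolding expect_on_def by (rule sum.cong) (simp_all add: pmf_q)
  also have "\<dots> = (\<Sum>i=1..k. w (xs i) * f (xs i))"
    using k w_high by (intro sum_initial_segment) auto
  also have "\<dots> = (\<Sum>i=1..k. pmf p (xs i) * f (xs i) / m k
      + c * \<mu> k / m k * (pmf p (xs i) * (\<mu> k - f (xs i)))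
      - c / m k * (pmf p (xs i) * (f (xs i) - \<mu> k)\<^sup>2))"
  proof (rule sum.cong[OF refl])
    fix i assume "i \<in> {1..k}"
    then show "w (xs i) * f (xs i) = pmf p (xs i) * f (xs i) / m k
      + c * \<mu> k / m k * (pmf p (xs i) * (\<mu> k - f (xs i)))
      - c / m k * (pmf p (xs i) * (f (xs i) - \<mu> k)\<^sup>2)"
      using mk by (simp add: w_low divide_simps) (simp add: power2_eq_square algebra_simps)
  qed
  also have "\<dots> = m k * \<mu> k / m k - c / m k * (m k * v k)"
    by (simp only: sum.distrib sum_subtractf sum_divide_distrib[symmetric]
        sum_distrib_left[symmetric] mean0 mass_var[OF k] mass_mean[OF k])
  also have "\<dots> = \<mu> k - c * v k" using mk by simp
  finally have ex: "expect_on X q f = \<mu> k - c * v k" .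
  show ?thesis
    using that[OF q _ div ex] w_xs pmf_q xs_in by simp
qed

section \<open>The two cases of the formula\<close>

text \<open>The assumption says that \<open>p\<close> conditioned on the minimisers of \<open>f\<close> lies in the ball.\<close>

lemma lower_expectation_minimum:
  assumes "1 \<le> m l * (1 + \<delta>)"
  shows "chi2_lower_expectation X p \<delta> f = f (xs 1)"
proof -
  obtain q where q: "q \<in> pmfs_on X"
    and div: "chi2_div X q p = 1 / m l - 1" and ex: "expect_on X q f = f (xs 1)"
    by (rule tilted_pmf[OF last_min(1), of 0]) (auto simp: mean_l)
  have "chi2_lower_expectation X p \<delta> f = expect_on X q f"
  proof (rule chi2_lower_expectation_eqI)
    show "q \<in> chi2_ball X p \<delta>"
      using q assms mass_pos[OF last_min(1)] by (simp add: chi2_ball_def div field_simps)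
  next
    fix q' assume "q' \<in> chi2_ball X p \<delta>"
    then have q': "q' \<in> pmfs_on X" by (simp add: chi2_ball_def)
    have "f (xs 1) \<le> f x" if x: "x \<in> X" for x
    proof -
      obtain i where "i \<in> {1..n}" "x = xs i" using bij x by (auto simp: bij_betw_def)
      then show ?thesis using f_le[of 1 i] by auto
    qed
    then have "(\<Sum>x\<in>X. pmf q' x * f (xs 1)) \<le> expect_on X q' f"
      unfolding expect_on_def by (intro sum_mono mult_left_mono) auto
    then show "expect_on X q f \<le> expect_on X q' f"
      using sum_pmf_on[OF fin q'] ex by (simp add: sum_distrib_right[symmetric])
  qed
  then show ?thesis using ex by simp
qed

text \<open>The tilt \<open>c\<close> that reaches the boundary of the ball satisfies \<open>c\<^sup>2 * v k = m k * (1 + \<delta>) - 1\<close>. The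
  premise \<open>primal\<close> therefore says \<open>c * (f (xs k) - \<mu> k) \<le> 1\<close>, which makes the tilted weights
  nonnegative, and the premise \<open>dual\<close> says that the affine density is nonpositive beyond \<open>xs k\<close>.
  Strict positivity of \<open>m k * (1 + \<delta>) - 1\<close> makes \<open>c\<close> a genuine multiplier.\<close>

lemma lower_expectation_tilted:
  assumes k: "l < k" "k \<le> n"
    and excess: "0 < m k * (1 + \<delta>) - 1"
    and primal: "m k * (1 + \<delta>) - 1 \<le> v k / (f (xs k) - \<mu> k)\<^sup>2"
    and dual: "k < n \<Longrightarrow> v k / (f (xs (Suc k)) - \<mu> k)\<^sup>2 \<le> m k * (1 + \<delta>) - 1"
  shows "chi2_lower_expectation X p \<delta> f = \<mu> k - sqrt (v k) * sqrt (m k * (1 + \<delta>) - 1)"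
proof -
  define s c where "s = sqrt (m k * (1 + \<delta>) - 1)" and "c = s / sqrt (v k)"
  have kn: "k \<in> {1..n}" using k by auto
  have vk: "0 < v k" and mk: "0 < m k" using var_pos[OF k] mass_pos[OF kn] by auto
  have s: "0 < s" "s\<^sup>2 = m k * (1 + \<delta>) - 1" using excess by (auto simp: s_def)
  have c: "0 < c" using s vk by (simp add: c_def)
  have c2: "c\<^sup>2 * v k = s\<^sup>2" and cv: "c * v k = sqrt (v k) * s"
    using vk by (auto simp: c_def power_divide) (metis less_eq_real_def real_div_sqrt times_divide_eq_right mult.commute)
  have c_below: "c * (f (xs i) - \<mu> k) \<le> 1" if "i \<in> {1..k}" for i
  proof -
    have d: "0 < f (xs k) - \<mu> k" using mean_less[OF k] by simp
    have "(c * (f (xs k) - \<mu> k))\<^sup>2 * v k = s\<^sup>2 * (f (xs k) - \<mu> k)\<^sup>2"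
      unfolding c2[symmetric] by (simp add: power_mult_distrib mult_ac)
    also have "\<dots> \<le> v k" using primal d by (simp add: s(2) pos_le_divide_eq)
    finally have "(c * (f (xs k) - \<mu> k))\<^sup>2 \<le> 1\<^sup>2" using vk by simp
    then have "c * (f (xs k) - \<mu> k) \<le> 1" by (rule power2_le_imp_le) simp
    moreover have "c * (f (xs i) - \<mu> k) \<le> c * (f (xs k) - \<mu> k)"
      using f_le[of i k] that k c by (intro mult_left_mono) auto
    ultimately show ?thesis by linarith
  qed
  have c_above: "1 \<le> c * (f (xs i) - \<mu> k)" if i: "k < i" "i \<le> n" for i
  proof -
    have d: "0 < f (xs (Suc k)) - \<mu> k" using mean_less_Suc[of k] k i by simp
    have "v k \<le> s\<^sup>2 * (f (xs (Suc k)) - \<mu> k)\<^sup>2"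
      using dual i d by (simp add: s(2) pos_divide_le_eq)
    also have "\<dots> = (c * (f (xs (Suc k)) - \<mu> k))\<^sup>2 * v k"
      unfolding c2[symmetric] by (simp add: power_mult_distrib mult_ac)
    finally have "1\<^sup>2 \<le> (c * (f (xs (Suc k)) - \<mu> k))\<^sup>2" using vk by simp
    then have "1 \<le> c * (f (xs (Suc k)) - \<mu> k)" by (rule power2_le_imp_le) (use c d in simp)
    moreover have "c * (f (xs (Suc k)) - \<mu> k) \<le> c * (f (xs i) - \<mu> k)"
      using f_le[of "Suc k" i] i c by (intro mult_left_mono) auto
    ultimately show ?thesis by linarith
  qed
  obtain q where q: "q \<in> pmfs_on X"
    and pmf_q: "\<And>i. i \<in> {1..n} \<Longrightarrow>
      pmf q (xs i) = (if i \<le> k then pmf p (xs i) / m k * (1 - c * (f (xs i) - \<mu> k)) else 0)"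
    and div: "chi2_div X q p = (1 + c\<^sup>2 * v k) / m k - 1"
    and ex: "expect_on X q f = \<mu> k - c * v k"
    using tilted_pmf[OF kn c_below] by metis
  (* the tilted density as a - (c / m k) * f, the form of the Lagrange multipliers *)
  define a where "a = (1 + c * \<mu> k) / m k"
  have affine: "pmf p x * (a - c / m k * f x) = pmf p x / m k * (1 - c * (f x - \<mu> k))" for x
    using mk by (simp add: a_def field_simps)
  have "chi2_lower_expectation X p \<delta> f = expect_on X q f"
  proof (rule chi2_lower_expectation_lagrange[OF fin p_on p_pos q, where c = "c / m k" and a = a])
    show "chi2_div X q p = \<delta>" unfolding div c2 s(2) using mk by (simp add: field_simps)
    show "0 < c / m k" using c mk by simp
  next
    fix x assume "x \<in> X"
    then obtain i where i: "i \<in> {1..n}" and x: "x = xs i" using bij by (auto simp: bij_betw_def)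
    show "pmf p x * (a - c / m k * f x) \<le> pmf q x"
      unfolding affine unfolding x pmf_q[OF i] using c_above[of i] i mk
      by (auto simp: divide_le_0_iff mult_le_0_iff)
    show "pmf q x = 0 \<or> pmf q x = pmf p x * (a - c / m k * f x)"
      unfolding affine unfolding x pmf_q[OF i] by simp
  qed
  then show ?thesis using ex cv by (simp add: s_def)
qed

end

section \<open>The lower expectation\<close>

theorem theorem2:
  fixes X :: "'a set" and n l r :: nat and p :: "'a pmf" and \<delta> :: real
    and f :: "'a \<Rightarrow> real" and xs :: "nat \<Rightarrow> 'a"
  assumes "finite X" and "X \<noteq> {}" and "card X = n"
    and "p \<in> pmfs_on X" and "\<forall>x\<in>X. pmf p x > 0"
    and "\<delta> \<ge> 0"
    and "bij_betw xs {1..n} X"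
    and "mono_on {1..n} (\<lambda>i. f (xs i))"
    and "l = last_min_index f xs n"
    and "r = Max {k \<in> {l..n}. delta_threshold p f xs n k > ereal \<delta>}"
  shows "chi2_lower_expectation X p \<delta> f =
    (if r > l
     then partial_mean p f xs r
            - partial_sd p f xs r * sqrt (partial_mass p xs r * \<delta> - (1 - partial_mass p xs r))
     else f (xs 1))"
proof -
  interpret E: ordered_enumeration X p f xs n
    using assms by unfold_locales auto
  have l: "last_min_index f xs n = l" using assms(9) by simp
  have l_in: "l \<in> {1..n}" using E.last_min(1) by (simp add: l)
  define K where "K = {k \<in> {l..n}. delta_threshold p f xs n k > ereal \<delta>}"
  have "finite K" by (simp add: K_def)
  moreover have "l \<in> K" using l_in by (simp add: K_def delta_threshold_def l)
  ultimately have r_in: "r \<in> K" and r_max: "\<And>k. k \<in> K \<Longrightarrow> k \<le> r"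
    unfolding assms(10) K_def[symmetric] by (auto intro: Max_in Max_ge)
  have r: "l \<le> r" "r \<le> n" and r_range: "r \<in> {1..n}" using r_in l_in by (auto simp: K_def)
  have mr: "0 < partial_mass p xs r" by (rule E.mass_pos[OF r_range])
  have dual: "partial_var p f xs r / (f (xs (Suc r)) - partial_mean p f xs r)\<^sup>2
      \<le> partial_mass p xs r * (1 + \<delta>) - 1" if "r < n"
  proof -
    have "Suc r \<notin> K" using r_max[of "Suc r"] by auto
    then have "E.threshold (Suc r) \<le> \<delta>"
      using E.delta_threshold_less_iff[of "Suc r" \<delta>] r that by (auto simp: K_def l)
    then have "partial_mass p xs r * (1 + E.threshold (Suc r)) \<le> partial_mass p xs r * (1 + \<delta>)"
      using mr by simp
    then show ?thesis using E.threshold_Suc[of r] r that by (simp add: l)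
  qed
  have whole: "partial_mass p xs r * (1 + \<delta>) - 1 = \<delta>" if "r = n"
    using E.mass_n that by simp
  show ?thesis
  proof (cases "l < r")
    case False
    then have rl: "r = l" using r by simp
    have "1 \<le> partial_mass p xs l * (1 + \<delta>)"
    proof (cases "r < n")
      case True
      then show ?thesis using dual rl E.var_l by (simp add: l)
    next
      case False
      then show ?thesis using whole r rl assms(6) by simp
    qed
    then show ?thesis using E.lower_expectation_minimum[of \<delta>] False by (simp add: l)
  next
    case True
    have form: "partial_mass p xs r * \<delta> - (1 - partial_mass p xs r)
        = partial_mass p xs r * (1 + \<delta>) - 1" by (simp add: algebra_simps)
    show ?thesis
    proof (cases "0 < partial_mass p xs r * (1 + \<delta>) - 1")
      case pos: True
      have "\<delta> < E.threshold r"
        using r_in E.delta_threshold_less_iff[of r \<delta>] True by (simp add: K_def l)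
      then have "partial_mass p xs r * (1 + \<delta>) \<le> partial_mass p xs r * (1 + E.threshold r)"
        using mr by simp
      then have primal: "partial_mass p xs r * (1 + \<delta>) - 1
          \<le> partial_var p f xs r / (f (xs r) - partial_mean p f xs r)\<^sup>2"
        using E.threshold_same[of r] True r by (simp add: l)
      show ?thesis
        using E.lower_expectation_tilted[of r \<delta>, OF _ r(2) pos primal dual] True
        by (simp add: form partial_sd_def l)
    next
      case nonpos: False
      (* r < n would force a positive excess, because the variance of the segment is positive *)
      have "r = n"
      proof (rule ccontr)
        assume "r \<noteq> n"
        then have "r < n" using r by simp
        then have "0 < partial_var p f xs r / (f (xs (Suc r)) - partial_mean p f xs r)\<^sup>2"
          using E.var_pos[of r] E.mean_less_Suc[of r] True r by (auto simp: l)
        then show False using dual[OF \<open>r < n\<close>] nonpos by linarith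
      qed
      then have \<delta>: "\<delta> = 0" using nonpos whole assms(6) by simp
      have "chi2_lower_expectation X p \<delta> f = expect_on X p f"
        unfolding chi2_lower_expectation_def \<delta>
        using chi2_ball_zero[OF E.fin E.p_on E.p_pos] by simp
      also have "\<dots> = partial_mean p f xs r"
        using E.mass_mean[OF r_range] E.mass_n \<open>r = n\<close> by (simp add: expect_on_def E.sum_reindex)
      finally show ?thesis using True \<delta> E.mass_n \<open>r = n\<close> by simp
    qed
  qed
qed

end
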